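(* If $M \models \mathsf{UDLO}$ and $A \subseteq M$, then $\mathrm{acl}(A)$ is the metric closure of $A$.
   Context: A metric linear order is a set with a linear order $\le$ and metric $d$ such that every open ball is order-convex, treated in continuous logic in the language $\{d_\le,r\}$ with $r(x,y)=\inf_{z\le y}d(x,z)$ and $d_\le(x,y)$ the distance from $(x,y)$ to $\{(w,z): w\le z\}$. $\mathsf{UDLO}$ is the theory of complete metric linear orders of diameter $\le1$ whose metric is an ultrametric and such that for every $a$, both $\{d(a,b):b<a\}$ and $\{d(a,b):b>a\}$ are dense in $[0,1]$ (axiomatized by the ultrametric axiom and $\sup_x\inf_y|r(x,y)-p|=0$, $\sup_x\inf_y|r(y,x)-p|=0$ for rational $p\in[0,1]$). A closed nonempty set $D\subseteq M^n$ is $A$-definable if $x\mapsto \inf_{a\in D}d(x,a)$ is a definable predicate with parameters from $A$ (a uniform limit of formulas with parameters from $A$). A point $b$ is algebraic over $A$ if it lies in some compact $A$-definable set; $\mathrm{acl}(A)$ is the set of such points. *)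

theory Defs
  imports "HOL-Analysis.Analysis"
begin

class metric_linorder = linorder + metric_space +
  assumes ball_order_convex:
    "dist c a < e \<Longrightarrow> dist c b < e \<Longrightarrow> a \<le> x \<Longrightarrow> x \<le> b \<Longrightarrow> dist c x < e"

class udlo = metric_linorder + complete_space +
  assumes dist_le_one: "dist a b \<le> 1"
    and ultrametric: "dist a c \<le> max (dist a b) (dist b c)"
    and dense_dist_below: "{0..1} \<subseteq> closure {dist a b |b. b < a}"
    and dense_dist_above: "{0..1} \<subseteq> closure {dist a b |b. a < b}"

definition r :: "'a::metric_linorder \<Rightarrow> 'a \<Rightarrow> real" where
  "r x y = (INF z\<in>{..y}. dist x z)"

text \<open>Powers of a metric structure carry the maximum metric; the library metric on products is the
  Euclidean one.\<close>

definition d_le :: "'a::metric_linorder \<Rightarrow> 'a \<Rightarrow> real" where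
  "d_le x y = (INF (w, z)\<in>{(w, z). w \<le> z}. max (dist x w) (dist y z))"

datatype 'a tm = Var nat | Param 'a

text \<open>In \<open>Conn u \<phi>s\<close> the connective \<open>u\<close> has arity \<open>length \<phi>s\<close>: only its restriction to
  \<open>{..<length \<phi>s} \<rightarrow>\<^sub>E {0..1}\<close> is relevant, and \<open>formula_over\<close> requires this to be a
  continuous map from $[0,1]^n$ to $[0,1]$.\<close>

datatype 'a fm =
    Dist "'a tm" "'a tm"
  | Dle "'a tm" "'a tm"
  | Rel_r "'a tm" "'a tm"
  | Conn "(nat \<Rightarrow> real) \<Rightarrow> real" "'a fm list"
  | Sup_q nat "'a fm"
  | Inf_q nat "'a fm"

fun tm_val :: "'a tm \<Rightarrow> (nat \<Rightarrow> 'a) \<Rightarrow> 'a" where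
  "tm_val (Var i) v = v i"
| "tm_val (Param a) v = a"

fun fm_val :: "'a::metric_linorder fm \<Rightarrow> (nat \<Rightarrow> 'a) \<Rightarrow> real" where
  "fm_val (Dist s t) v = dist (tm_val s v) (tm_val t v)"
| "fm_val (Dle s t) v = d_le (tm_val s v) (tm_val t v)"
| "fm_val (Rel_r s t) v = r (tm_val s v) (tm_val t v)"
| "fm_val (Conn u \<phi>s) v = u (restrict (nth (map (\<lambda>\<phi>. fm_val \<phi> v) \<phi>s)) {..<length \<phi>s})"
| "fm_val (Sup_q i \<phi>) v = (SUP a. fm_val \<phi> (v(i := a)))"
| "fm_val (Inf_q i \<phi>) v = (INF a. fm_val \<phi> (v(i := a)))"

fun tm_vars :: "'a tm \<Rightarrow> nat set" where
  "tm_vars (Var i) = {i}"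
| "tm_vars (Param a) = {}"

fun free_vars :: "'a fm \<Rightarrow> nat set" where
  "free_vars (Dist s t) = tm_vars s \<union> tm_vars t"
| "free_vars (Dle s t) = tm_vars s \<union> tm_vars t"
| "free_vars (Rel_r s t) = tm_vars s \<union> tm_vars t"
| "free_vars (Conn u \<phi>s) = (\<Union>\<phi>\<in>set \<phi>s. free_vars \<phi>)"
| "free_vars (Sup_q i \<phi>) = free_vars \<phi> - {i}"
| "free_vars (Inf_q i \<phi>) = free_vars \<phi> - {i}"

definition connective :: "nat \<Rightarrow> ((nat \<Rightarrow> real) \<Rightarrow> real) \<Rightarrow> bool" where
  "connective n u \<longleftrightarrow>
     continuous_map (product_topology (\<lambda>_. top_of_set {0..1}) {..<n}) (top_of_set {0..1}) u"

fun formula_over :: "'a set \<Rightarrow> 'a fm \<Rightarrow> bool" where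
  "formula_over A (Dist s t) \<longleftrightarrow> set_tm s \<union> set_tm t \<subseteq> A"
| "formula_over A (Dle s t) \<longleftrightarrow> set_tm s \<union> set_tm t \<subseteq> A"
| "formula_over A (Rel_r s t) \<longleftrightarrow> set_tm s \<union> set_tm t \<subseteq> A"
| "formula_over A (Conn u \<phi>s) \<longleftrightarrow> connective (length \<phi>s) u \<and> (\<forall>\<phi>\<in>set \<phi>s. formula_over A \<phi>)"
| "formula_over A (Sup_q i \<phi>) \<longleftrightarrow> formula_over A \<phi>"
| "formula_over A (Inf_q i \<phi>) \<longleftrightarrow> formula_over A \<phi>"

text \<open>An \<open>n\<close>-ary predicate is represented as a function of assignments, of which only the values
  at the variables \<open>0, \<dots>, n - 1\<close> matter.\<close>

definition definable_pred ::
    "'a::metric_linorder set \<Rightarrow> nat \<Rightarrow> ((nat \<Rightarrow> 'a) \<Rightarrow> real) \<Rightarrow> bool" where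
  "definable_pred A n P \<longleftrightarrow>
     (\<exists>\<phi>. (\<forall>k. formula_over A (\<phi> k) \<and> free_vars (\<phi> k) \<subseteq> {..<n}) \<and>
          uniform_limit UNIV (\<lambda>k. fm_val (\<phi> k)) P sequentially)"

definition definable_set :: "'a::metric_linorder set \<Rightarrow> 'a set \<Rightarrow> bool" where
  "definable_set A D \<longleftrightarrow>
     closed D \<and> D \<noteq> {} \<and> definable_pred A 1 (\<lambda>v. infdist (v 0) D)"

definition acl :: "'a::metric_linorder set \<Rightarrow> 'a set" where
  "acl A = {b. \<exists>D. compact D \<and> definable_set A D \<and> b \<in> D}"

end

theory Submission
  imports Defs
begin

text \<open>Fix a resolution \<open>N\<close> and remember of a distance only which of the conditions
  \<open>dist a b \<le> k / N\<close> with \<open>1 \<le> k\<close> hold, and of the order only the comparisons of points at distance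
  more than \<open>1 / N\<close>. Each of these nested convex equivalence relations splits every class of the next
  one into a dense order without endpoints, so finite partial maps preserving this information extend
  by back-and-forth with no loss. Letting \<open>N\<close> grow, the value of a formula depends only on the order
  and the distances of its arguments and parameters. If a ball around \<open>b\<close> misses \<open>A\<close>, all its points
  are related to \<open>A\<close> in the same way, so every \<open>A\<close>-definable set containing \<open>b\<close> contains the
  ball, which is not totally bounded.\<close>

section \<open>Ultrametric linear orders\<close>

text \<open>If an inequality failed, the open ball around one endpoint with its distance to
  \<open>b\<close> as radius would contain both endpoints but not \<open>b\<close>, against
  convexity.\<close>

lemma dist_mono_between:
  fixes a b c :: "'a::metric_linorder"
  assumes "a \<le> b" "b \<le> c"
  shows "dist a b \<le> dist a c" "dist b c \<le> dist a c"
proof -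
  show "dist a b \<le> dist a c"
  proof (rule ccontr)
    assume "\<not> dist a b \<le> dist a c"
    then have "dist a b < dist a b"
      using ball_order_convex[of a a "dist a b" c b] assms
      by (metis dist_self linorder_not_le order_le_less_trans zero_le_dist)
    then show False by simp
  qed
  show "dist b c \<le> dist a c"
  proof (rule ccontr)
    assume "\<not> dist b c \<le> dist a c"
    then have "dist c b < dist b c"
      using ball_order_convex[of c a "dist b c" c b] assms
      by (metis dist_commute dist_self linorder_not_le order_le_less_trans zero_le_dist)
    then show False by (simp add: dist_commute)
  qed
qed

lemma r_eq: "r x y = (if x \<le> y then 0 else dist x y)"
proof -
  have "r x y \<le> dist x z" if "z \<le> y" for z
    unfolding r_def using that by (intro cINF_lower) (auto intro: bdd_belowI2[where m = 0])
  moreover have "0 \<le> r x y"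
    unfolding r_def by (intro cINF_greatest) auto
  moreover have "dist x y \<le> r x y" if "\<not> x \<le> y"
    unfolding r_def using that
    by (intro cINF_greatest) (auto simp: dist_commute[of x] intro: dist_mono_between)
  ultimately show ?thesis
    by (smt (verit) dist_self order_refl)
qed

text \<open>For \<open>y < x\<close>, a pair \<open>w \<le> z\<close> nearer to
  \<open>(x, y)\<close> than \<open>dist x y\<close> would have \<open>w\<close> above
  \<open>y\<close>, since \<open>w\<close> is near \<open>x\<close>. Then \<open>w\<close> lies
  between \<open>y\<close> and \<open>z\<close>, so it is near \<open>y\<close> as well, and the
  ultrametric inequality through \<open>w\<close> fails. Hence \<open>d_le\<close> and
  \<open>r\<close> take the same values.\<close>

lemma d_le_eq:
  fixes x y :: "'a::udlo"
  shows "d_le x y = (if x \<le> y then 0 else dist x y)"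
proof -
  have upper: "d_le x y \<le> max (dist x w) (dist y z)" if "w \<le> z" for w z
  proof -
    have "bdd_below ((\<lambda>(w, z). max (dist x w) (dist y z)) ` {(w, z). w \<le> z})"
      by (rule bdd_belowI2[where m = 0]) (auto simp: le_max_iff_disj)
    from cINF_lower[OF this, of "(w, z)"] that show ?thesis
      by (simp add: d_le_def)
  qed
  have ne: "{(w, z). w \<le> (z::'a)} \<noteq> {}" by auto
  have nonneg: "0 \<le> d_le x y"
    unfolding d_le_def by (intro cINF_greatest[OF ne]) (auto simp: le_max_iff_disj)
  have lower: "dist x y \<le> d_le x y" if "y < x"
  proof -
    have "dist x y \<le> max (dist x w) (dist y z)" if "w \<le> z" for w z
    proof (rule ccontr)
      assume "\<not> ?thesis"
      then have w: "dist x w < dist x y" and z: "dist y z < dist x y" by auto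
      have "y < w"
      proof (rule ccontr)
        assume "\<not> y < w"
        then have "dist y x \<le> dist w x" using \<open>y < x\<close> by (intro dist_mono_between) auto
        with w show False by (simp add: dist_commute)
      qed
      then have "dist y w \<le> dist y z" using \<open>w \<le> z\<close> by (intro dist_mono_between) auto
      with ultrametric[of x y w] w z show False by (simp add: dist_commute)
    qed
    then show ?thesis
      unfolding d_le_def by (intro cINF_greatest[OF ne]) auto
  qed
  show ?thesis
    using upper[of x y] upper[of x x] nonneg lower by (auto simp: dist_commute)
qed

section \<open>Realizing distances and filling cuts\<close>

lemma exists_above_with_dist:
  fixes a :: "'a::udlo"
  assumes "0 \<le> s" "s < t" "t \<le> 1"
  shows "\<exists>b>a. s < dist a b \<and> dist a b < t"
proof -
  have "(s + t) / 2 \<in> closure {dist a b |b. a < b}"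
    using assms by (intro subsetD[OF dense_dist_above]) auto
  then obtain d where "d \<in> {dist a b |b. a < b}" "dist d ((s + t) / 2) < (t - s) / 2"
    using assms unfolding closure_approachable by (meson diff_gt_0_iff_gt half_gt_zero)
  then show ?thesis by (auto simp: dist_real_def abs_if field_simps split: if_splits)
qed

lemma exists_below_with_dist:
  fixes a :: "'a::udlo"
  assumes "0 \<le> s" "s < t" "t \<le> 1"
  shows "\<exists>b<a. s < dist a b \<and> dist a b < t"
proof -
  have "(s + t) / 2 \<in> closure {dist a b |b. b < a}"
    using assms by (intro subsetD[OF dense_dist_below]) auto
  then obtain d where "d \<in> {dist a b |b. b < a}" "dist d ((s + t) / 2) < (t - s) / 2"
    using assms unfolding closure_approachable by (meson diff_gt_0_iff_gt half_gt_zero)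
  then show ?thesis by (auto simp: dist_real_def abs_if field_simps split: if_splits)
qed

text \<open>Only the points next to the gap matter: once \<open>y\<close> is placed correctly
  relative to \<open>Max L\<close> or \<open>Min R\<close>, monotonicity of distances gives the
  lower bound for the points behind them, and the ultrametric inequality with \<open>diam\<close>
  gives the upper bound.\<close>

lemma fill_cut:
  fixes L R :: "'a::udlo set"
  assumes fin: "finite L" "finite R" and ne: "L \<union> R \<noteq> {}"
    and st: "0 \<le> s" "s < t" "t \<le> 1"
    and cut: "\<And>p q. p \<in> L \<Longrightarrow> q \<in> R \<Longrightarrow> p < q \<and> s < dist p q"
    and diam: "\<And>p q. p \<in> L \<union> R \<Longrightarrow> q \<in> L \<union> R \<Longrightarrow> dist p q \<le> t"
  shows "\<exists>y. (\<forall>p\<in>L. p < y) \<and> (\<forall>q\<in>R. y < q) \<and> (\<forall>p\<in>L \<union> R. s < dist y p \<and> dist y p \<le> t)"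
proof -
  have left: "p < y \<and> s < dist y p \<and> dist y p \<le> t"
    if "p \<in> L" "Max L < y" "s < dist (Max L) y" "dist (Max L) y \<le> t" for p y
  proof -
    have "p \<le> Max L" using that fin by simp
    moreover have "Max L \<in> L" using that fin Max_in[of L] by blast
    moreover from calculation have "dist (Max L) y \<le> dist p y"
      using that by (intro dist_mono_between) auto
    ultimately show ?thesis
      using that ultrametric[of p y "Max L"] diam[of p "Max L"]
      by (auto simp: dist_commute)
  qed
  have right: "y < q \<and> s < dist y q \<and> dist y q \<le> t"
    if "q \<in> R" "y < Min R" "s < dist (Min R) y" "dist (Min R) y \<le> t" for q y
  proof -
    have "Min R \<le> q" using that fin by simp
    moreover have "Min R \<in> R" using that fin Min_in[of R] by blast
    moreover from calculation have "dist y (Min R) \<le> dist y q"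
      using that by (intro dist_mono_between) auto
    ultimately show ?thesis
      using that ultrametric[of q y "Min R"] diam[of q "Min R"]
      by (auto simp: dist_commute)
  qed
  consider "L = {}" "R \<noteq> {}" | "L \<noteq> {}" "R = {}" | "L \<noteq> {}" "R \<noteq> {}" using ne by auto
  then show ?thesis
  proof cases
    case 1
    with exists_below_with_dist[OF st, of "Min R"] right show ?thesis
      by (metis Un_iff empty_iff less_imp_le)
  next
    case 2
    with exists_above_with_dist[OF st, of "Max L"] left show ?thesis
      by (metis Un_iff empty_iff less_imp_le)
  next
    case 3
    then have mem: "Max L \<in> L" "Min R \<in> R" using fin by auto
    let ?m = "dist (Max L) (Min R)"
    have m: "Max L < Min R" "s < ?m" "?m \<le> t" using cut[OF mem] diam mem by auto
    \<comment> \<open>Staying strictly below \<open>?m\<close> prevents \<open>y\<close> from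
      reaching \<open>Min R\<close>, and by the ultrametric inequality it forces
      \<open>dist y (Min R)\<close> to be at least \<open>?m\<close>, hence above
      \<open>s\<close>.\<close>
    obtain y where y: "Max L < y" "s < dist (Max L) y" "dist (Max L) y < ?m"
      using exists_above_with_dist[of s ?m "Max L"] st m by auto
    have "y < Min R"
      using y m dist_mono_between(1)[of "Max L" "Min R" y] by (meson leD less_imp_le not_le)
    moreover have "dist (Min R) y \<le> t" "s < dist (Min R) y"
      using y m ultrametric[of "Min R" y "Max L"] ultrametric[of "Max L" "Min R" y]
      by (auto simp: dist_commute)
    ultimately show ?thesis
      using left[of _ y] right[of _ y] y m by (intro exI[of _ y]) auto
  qed
qed

section \<open>Back-and-forth at a finite resolution\<close>

text \<open>Closed conditions \<open>dist a b \<le> k / N\<close> are essential: modulo the points at distance strictly less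
  than \<open>s\<close>, a closed ball of radius \<open>s\<close> can be a finite order, so strict inequalities would not give
  dense quotients. The maximum with 1 merges distance 0 with the first step.\<close>

definition lev :: "nat \<Rightarrow> 'a::metric_space \<Rightarrow> 'a \<Rightarrow> int" where
  "lev N a b = max 1 \<lceil>real N * dist a b\<rceil>"

lemma lev_ge_1: "1 \<le> lev N a b"
  by (simp add: lev_def)

lemma lev_self [simp]: "lev N a a = 1"
  by (simp add: lev_def)

lemma lev_commute: "lev N a b = lev N b a"
  by (simp add: lev_def dist_commute)

lemma lev_mono: "dist a b \<le> dist c d \<Longrightarrow> lev N a b \<le> lev N c d"
  unfolding lev_def by (intro max.mono order_refl ceiling_mono mult_left_mono) auto

lemma lev_le_iff: "0 < N \<Longrightarrow> 1 \<le> k \<Longrightarrow> lev N a b \<le> k \<longleftrightarrow> dist a b \<le> real_of_int k / real N"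
  by (simp add: lev_def ceiling_le_iff field_simps)

lemma lev_ultrametric:
  fixes a b c :: "'a::udlo"
  shows "lev N a c \<le> max (lev N a b) (lev N b c)"
  using ultrametric[of a c b] lev_mono[of a c a b N] lev_mono[of a c b c N]
  by (auto simp: max_def split: if_splits)

text \<open>Levels inherit the ultrametric inequality, so the two largest levels in a triangle
  agree.\<close>

lemma lev_eq_of_less:
  fixes a b c :: "'a::udlo"
  assumes "lev N a b < lev N a c"
  shows "lev N b c = lev N a c"
  using lev_ultrametric[of N a c b] lev_ultrametric[of N b c a] assms
  by (auto simp: lev_commute[of N b a])

text \<open>If \<open>c\<close> separated \<open>a\<close> from \<open>b\<close>, it would be no
  farther from \<open>a\<close> than \<open>b\<close> is.\<close>

lemma less_iff_of_lev_less:
  fixes a b c :: "'a::udlo"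
  assumes "lev N a b < lev N a c"
  shows "a < c \<longleftrightarrow> b < c"
proof
  assume "a < c"
  show "b < c"
  proof (rule ccontr)
    assume "\<not> b < c"
    then have "lev N a c \<le> lev N a b" using \<open>a < c\<close> by (intro lev_mono dist_mono_between) auto
    with assms show False by simp
  qed
next
  assume "b < c"
  show "a < c"
  proof (rule ccontr)
    assume "\<not> a < c"
    then have "lev N c a \<le> lev N b a" using \<open>b < c\<close> by (intro lev_mono dist_mono_between) auto
    with assms show False by (simp add: lev_commute)
  qed
qed

text \<open>A relation rather than a function makes the condition invariant under converse, so the
  back move follows from the forth move. Points at level 1 are merged: their order may be reversed,
  and one point may be related to several.\<close>

definition grid_similar :: "nat \<Rightarrow> ('a::metric_linorder \<times> 'a) set \<Rightarrow> bool" where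
  "grid_similar N F \<longleftrightarrow>
     (\<forall>p q p' q'. (p, q) \<in> F \<longrightarrow> (p', q') \<in> F \<longrightarrow>
        lev N p p' = lev N q q' \<and> (1 < lev N p p' \<longrightarrow> (p < p' \<longleftrightarrow> q < q')))"

lemma grid_similarD:
  assumes "grid_similar N F" "(p, q) \<in> F" "(p', q') \<in> F"
  shows "lev N p p' = lev N q q'" "1 < lev N p p' \<Longrightarrow> p < p' \<longleftrightarrow> q < q'"
  using assms unfolding grid_similar_def by blast+

lemma grid_similar_subset: "grid_similar N F \<Longrightarrow> G \<subseteq> F \<Longrightarrow> grid_similar N G"
  unfolding grid_similar_def by blast

lemma grid_similar_converse: "grid_similar N F \<Longrightarrow> grid_similar N (F\<inverse>)"
  unfolding grid_similar_def by simp

lemma lev_gt_1_imp_neq: "1 < lev N a b \<Longrightarrow> a \<noteq> b"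
  by auto

lemma grid_similar_insert:
  assumes "grid_similar N F"
    and new: "\<And>p q. (p, q) \<in> F \<Longrightarrow>
      lev N x p = lev N y q \<and> (1 < lev N x p \<longrightarrow> (x < p \<longleftrightarrow> y < q))"
  shows "grid_similar N (insert (x, y) F)"
proof -
  have rev: "lev N p x = lev N q y \<and> (1 < lev N p x \<longrightarrow> (p < x \<longleftrightarrow> q < y))" if "(p, q) \<in> F" for p q
    using new[OF that] lev_gt_1_imp_neq[of N p x] lev_gt_1_imp_neq[of N q y]
    by (metis lev_commute less_asym linorder_less_linear)
  show ?thesis
    unfolding grid_similar_def using new rev grid_similarD[OF assms(1)] by auto
qed

text \<open>Let \<open>k\<close> be the least level from \<open>x\<close> to the domain, attained at
  \<open>p0\<close>. Any \<open>y\<close> within level \<open>k\<close> of \<open>q0\<close> is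
  automatically correct relative to the pairs farther than \<open>k\<close>. It remains to put
  \<open>y\<close> into the cut that \<open>x\<close> determines among the pairs at level exactly
  \<open>k\<close>, which density allows.\<close>

lemma grid_similar_extend:
  fixes F :: "('a::udlo \<times> 'a) set"
  assumes sim: "grid_similar N F" and fin: "finite F" and N: "0 < N"
  shows "\<exists>y. grid_similar N (insert (x, y) F)"
proof (cases "F = {}")
  case True
  then show ?thesis by (auto simp: grid_similar_def)
next
  case False
  define k where "k = Min ((\<lambda>(p, q). lev N x p) ` F)"
  have k_le: "k \<le> lev N x p" if "(p, q) \<in> F" for p q
    unfolding k_def using that fin by (intro Min_le) auto
  have "k \<in> (\<lambda>(p, q). lev N x p) ` F"
    unfolding k_def using fin False by (intro Min_in) auto
  then obtain p0 q0 where F0: "(p0, q0) \<in> F" and k0: "lev N x p0 = k" by auto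
  \<comment> \<open>Replace \<open>x\<close> by \<open>p0\<close>, pass through the similarity to
    \<open>q0\<close>, then replace \<open>q0\<close> by \<open>y\<close>. Each replacement moves by
    a level below that of the third point, so neither level nor side changes.\<close>
  have far: "lev N x p = lev N y q \<and> (x < p \<longleftrightarrow> y < q)"
    if pq: "(p, q) \<in> F" and gt: "k < lev N x p" and y: "lev N y q0 \<le> k" for p q y
  proof -
    have p: "lev N p0 p = lev N x p" "x < p \<longleftrightarrow> p0 < p"
      using gt k0 lev_eq_of_less[of N x p0 p] less_iff_of_lev_less[of N x p0 p] by auto
    moreover have q: "lev N q0 q = lev N p0 p" "p0 < p \<longleftrightarrow> q0 < q"
      using grid_similarD[OF sim F0 pq] p gt lev_ge_1[of N x p0] k0 by auto
    moreover have "lev N q0 y < lev N q0 q"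
      using gt y p q by (simp add: lev_commute)
    then have "lev N y q = lev N q0 q" "q0 < q \<longleftrightarrow> y < q"
      using lev_eq_of_less[of N q0 y q] less_iff_of_lev_less[of N q0 y q] by auto
    ultimately show ?thesis by simp
  qed
  have "\<exists>y. lev N y q0 \<le> k \<and>
    (\<forall>p q. (p, q) \<in> F \<longrightarrow> lev N x p = k \<longrightarrow> lev N y q = k \<and> (1 < k \<longrightarrow> (x < p \<longleftrightarrow> y < q)))"
  proof (cases "k = 1")
    case True
    \<comment> \<open>At the finest level order is not recorded, so \<open>q0\<close> itself can
      serve as the image of \<open>x\<close>.\<close>
    have "lev N q0 q = 1" if "(p, q) \<in> F" "lev N x p = 1" for p q
      using grid_similarD(1)[OF sim F0 that(1)] lev_ultrametric[of N p0 p x] that k0 True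
        lev_ge_1[of N p0 p] by (simp add: lev_commute)
    with True show ?thesis by (intro exI[of _ q0]) auto
  next
    case False
    then have k2: "2 \<le> k" using k0 lev_ge_1[of N x p0] by simp
    \<comment> \<open>Level \<open>k\<close> means exactly a distance in \<open>(s, t]\<close>, the
      range in which \<open>fill_cut\<close> places its point; \<open>2 \<le> k\<close> keeps
      \<open>k - 1\<close> within the scope of \<open>lev_le_iff\<close>.\<close>
    define s t where "s = real_of_int (k - 1) / N" and "t = real_of_int k / N"
    have lev_k: "lev N a b = k \<longleftrightarrow> s < dist a b \<and> dist a b \<le> t" for a b :: 'a
      using lev_le_iff[OF N, of k a b] lev_le_iff[OF N, of "k - 1" a b] k2
      unfolding s_def t_def by linarith
    have lev_le: "lev N a b \<le> k \<longleftrightarrow> dist a b \<le> t" for a b :: 'a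
      using lev_le_iff[OF N, of k a b] k2 unfolding t_def by simp
    \<comment> \<open>Diameter at most 1 bounds all levels by \<open>N\<close>, which gives
      \<open>t \<le> 1\<close>.\<close>
    have "k \<le> int N"
      using lev_le_iff[OF N, of "int N" x p0] N dist_le_one[of x p0] k0 by simp
    then have st: "0 \<le> s" "s < t" "t \<le> 1"
      using k2 N unfolding s_def t_def by (auto simp: field_simps)
    define L where "L = {q. \<exists>p. (p, q) \<in> F \<and> lev N x p = k \<and> p < x}"
    define R where "R = {q. \<exists>p. (p, q) \<in> F \<and> lev N x p = k \<and> x < p}"
    have LR: "q \<in> L \<union> R \<longleftrightarrow> (\<exists>p. (p, q) \<in> F \<and> lev N x p = k)" for q
    proof -
      have "x \<noteq> p" if "lev N x p = k" for p using that k2 by auto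
      then show ?thesis unfolding L_def R_def by (auto simp: neq_iff)
    qed
    have "L \<subseteq> snd ` F" "R \<subseteq> snd ` F" unfolding L_def R_def by force+
    then have finLR: "finite L" "finite R" using fin by (auto intro: finite_subset)
    have ne: "L \<union> R \<noteq> {}" using LR F0 k0 by blast
    have diam: "dist q q' \<le> t" if qq: "q \<in> L \<union> R" "q' \<in> L \<union> R" for q q'
    proof -
      obtain p p' where p: "(p, q) \<in> F" "lev N x p = k" "(p', q') \<in> F" "lev N x p' = k"
        using qq[unfolded LR] by blast
      then have "lev N q q' \<le> k"
        using grid_similarD(1)[OF sim p(1,3)] lev_ultrametric[of N p p' x] by (simp add: lev_commute)
      then show ?thesis by (simp add: lev_le)
    qed
    have cut: "q < q' \<and> s < dist q q'" if qq: "q \<in> L" "q' \<in> R" for q q'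
    proof -
      obtain p p' where p: "(p, q) \<in> F" "lev N x p = k" "p < x"
        and p': "(p', q') \<in> F" "lev N x p' = k" "x < p'"
        using qq unfolding L_def R_def by blast
      \<comment> \<open>Since \<open>x\<close> lies between \<open>p\<close> and \<open>p'\<close>,
        their level is at least \<open>k\<close>; \<open>diam\<close> bounds it by \<open>k\<close>
        on the image side. It is therefore exactly \<open>k > 1\<close>, where order is
        preserved.\<close>
      have "lev N p x \<le> lev N p p'"
        using p p' by (intro lev_mono dist_mono_between) auto
      moreover have "lev N q q' \<le> k" using diam[of q q'] qq by (simp add: lev_le)
      moreover have "lev N p p' = lev N q q'" using grid_similarD(1)[OF sim p(1) p'(1)] .
      ultimately have "lev N q q' = k" "lev N p p' = k" using p by (auto simp: lev_commute)
      moreover from this have "p < p' \<longleftrightarrow> q < q'"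
        using k2 by (intro grid_similarD(2)[OF sim p(1) p'(1)]) simp
      ultimately show ?thesis
        using p(3) p'(3) lev_k by auto
    qed
    obtain y where y: "\<forall>p\<in>L. p < y" "\<forall>q\<in>R. y < q" "\<forall>q\<in>L \<union> R. lev N y q = k"
      using fill_cut[OF finLR ne st cut diam] lev_k by metis
    have "lev N y q = k \<and> (x < p \<longleftrightarrow> y < q)" if pq: "(p, q) \<in> F" "lev N x p = k" for p q
    proof -
      have "x \<noteq> p" using pq k2 by auto
      then consider "p < x" "q \<in> L" | "x < p" "q \<in> R"
        using pq unfolding L_def R_def by (auto simp: neq_iff)
      then show ?thesis using y by cases auto
    qed
    with F0 k0 show ?thesis by (intro exI[of _ y]) auto
  qed
  then obtain y where y0: "lev N y q0 \<le> k"
    and near: "\<And>p q. (p, q) \<in> F \<Longrightarrow> lev N x p = k \<Longrightarrow>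
      lev N y q = k \<and> (1 < k \<longrightarrow> (x < p \<longleftrightarrow> y < q))" by blast
  have "grid_similar N (insert (x, y) F)"
  proof (rule grid_similar_insert[OF sim])
    fix p q assume "(p, q) \<in> F"
    then show "lev N x p = lev N y q \<and> (1 < lev N x p \<longrightarrow> (x < p \<longleftrightarrow> y < q))"
      using near far[OF _ _ y0] k_le by (cases "lev N x p = k") fastforce+
  qed
  then show ?thesis ..
qed

section \<open>Recovering distances and \<open>r\<close> up to \<open>1 / N\<close>\<close>

lemma lev_eq_imp_dist_close:
  assumes "0 < N" "lev N a b = lev N c d"
  shows "\<bar>dist a b - dist c d\<bar> \<le> 1 / N"
proof -
  let ?k = "lev N a b"
  have "dist a b \<le> ?k / N" "dist c d \<le> ?k / N"
    using lev_le_iff[OF assms(1) lev_ge_1, of a b N a b] lev_le_iff[OF assms(1) lev_ge_1, of c d N c d]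
      assms(2) by auto
  moreover have "(?k - 1) / N \<le> dist a b \<and> (?k - 1) / N \<le> dist c d"
  proof (cases "?k = 1")
    case False
    then have "1 \<le> ?k - 1" using lev_ge_1[of N a b] by simp
    from lev_le_iff[OF assms(1) this, of a b] lev_le_iff[OF assms(1) this, of c d] assms(2)
    show ?thesis by auto
  qed simp
  ultimately show ?thesis by (auto simp: diff_divide_distrib abs_if)
qed

lemma lev_eq_1_imp_dist: "0 < N \<Longrightarrow> lev N a b = 1 \<Longrightarrow> dist a b \<le> 1 / N"
  using lev_le_iff[of N 1 a b] by simp

text \<open>At level 1 the orders may disagree, but then both values of \<open>r\<close> are at most
  \<open>1 / N\<close>. At higher levels the order agrees and the distances are close.\<close>

lemma grid_similar_imp_r_close:
  assumes N: "0 < N" and sim: "grid_similar N F" "(p, q) \<in> F" "(p', q') \<in> F"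
  shows "\<bar>r p p' - r q q'\<bar> \<le> 1 / N"
proof (cases "lev N p p' = 1")
  case True
  then have "dist p p' \<le> 1 / N" "dist q q' \<le> 1 / N"
    using grid_similarD(1)[OF sim] lev_eq_1_imp_dist[OF N] by auto
  then show ?thesis
    using zero_le_dist[of p p'] zero_le_dist[of q q'] unfolding r_eq abs_le_iff by (smt (verit))
next
  case False
  then have gt: "1 < lev N p p'" using lev_ge_1[of N p p'] by simp
  then have "p \<noteq> p'" "q \<noteq> q'" using grid_similarD(1)[OF sim] lev_gt_1_imp_neq by auto
  then have "p \<le> p' \<longleftrightarrow> q \<le> q'" using grid_similarD(2)[OF sim gt] by (auto simp: le_less)
  then show ?thesis
    using lev_eq_imp_dist_close[OF N grid_similarD(1)[OF sim]] by (auto simp: r_eq)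
qed

section \<open>Values of formulas\<close>

text \<open>Precomposing \<open>u\<close> with restriction gives a continuous function on the full
  power of the unit interval, which is a compact metric space, so uniform continuity applies
  there.\<close>

lemma connective_uniformly_continuous:
  assumes u: "connective n u" and "0 < e"
  shows "\<exists>d>0. \<forall>x y. x \<in> {..<n} \<rightarrow>\<^sub>E {0..1} \<longrightarrow> y \<in> {..<n} \<rightarrow>\<^sub>E {0..1} \<longrightarrow>
    (\<forall>i<n. \<bar>x i - y i\<bar> \<le> d) \<longrightarrow> \<bar>u x - u y\<bar> \<le> e"
proof -
  let ?K = "Pi\<^sub>E UNIV (\<lambda>_. {0..1}) :: (nat \<Rightarrow> real) set"
  let ?f = "\<lambda>x. u (restrict x {..<n})"
  have K: "compact ?K"
    by (metis compactin_PiE compactin_euclidean_iff compact_Icc euclidean_product_topology)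
  have "continuous_map (top_of_set ?K) (product_topology (\<lambda>_. top_of_set {0..1}) {..<n})
      (\<lambda>x. restrict x {..<n})"
    by (auto simp: continuous_map_componentwise continuous_map_in_subtopology
        intro!: continuous_on_subset[OF continuous_on_product_coordinates])
  then have "continuous_map (top_of_set ?K) (top_of_set {0..1}) (u \<circ> (\<lambda>x. restrict x {..<n}))"
    using u unfolding connective_def by (rule continuous_map_compose)
  then have "continuous_on ?K ?f"
    by (simp add: continuous_map_in_subtopology o_def)
  then have "uniformly_continuous_on ?K ?f"
    using K by (rule compact_uniformly_continuous)
  then obtain d where d: "0 < d"
    "\<And>x y. x \<in> ?K \<Longrightarrow> y \<in> ?K \<Longrightarrow> dist x y < d \<Longrightarrow> dist (?f x) (?f y) < e"
    using \<open>0 < e\<close> unfolding uniformly_continuous_on_def by metis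
  \<comment> \<open>In the product metric the coordinates up to index \<open>M\<close> contribute at
    most twice their largest difference, here at most \<open>d / 2\<close>, and the remaining ones
    at most \<open>(1 / 2) ^ M\<close>.\<close>
  obtain M where M: "(1 / 2) ^ M < d / 2"
    using real_arch_pow_inv[of "d / 2" "1 / 2"] d(1) by auto
  have "\<bar>u x - u y\<bar> \<le> e"
    if x: "x \<in> {..<n} \<rightarrow>\<^sub>E {0..1}" and y: "y \<in> {..<n} \<rightarrow>\<^sub>E {0..1}"
      and xy: "\<forall>i<n. \<bar>x i - y i\<bar> \<le> d / 4" for x y
  proof -
    let ?x = "\<lambda>i. if i < n then x i else 0" and ?y = "\<lambda>i. if i < n then y i else 0"
    have "Max {dist (?x (from_nat k)) (?y (from_nat k)) |k. k \<le> M} \<le> d / 4"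
      using xy d(1) by (subst Max_le_iff) (auto simp: dist_real_def)
    then have "dist ?x ?y < d"
      using dist_fun_le_dist_first_terms[of ?x ?y M] M by linarith
    moreover have "?x \<in> ?K" "?y \<in> ?K" using x y by (auto simp: PiE_iff)
    moreover have "restrict ?x {..<n} = x" "restrict ?y {..<n} = y"
      using x y by (auto simp: PiE_iff extensional_def restrict_def fun_eq_iff)
    ultimately show ?thesis using d(2)[of ?x ?y] by (simp add: dist_real_def)
  qed
  with d(1) show ?thesis by (intro exI[of _ "d / 4"]) auto
qed

text \<open>Boundedness makes the real suprema and infima meaningful and keeps the arguments of
  connectives in their domain.\<close>

lemma fm_val_bounds:
  fixes v :: "nat \<Rightarrow> 'a::udlo"
  shows "formula_over A \<phi> \<Longrightarrow> fm_val \<phi> v \<in> {0..1}"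
proof (induction \<phi> arbitrary: v)
  case (Conn u \<phi>s)
  then have "restrict (nth (map (\<lambda>\<phi>. fm_val \<phi> v) \<phi>s)) {..<length \<phi>s} \<in> {..<length \<phi>s} \<rightarrow>\<^sub>E {0..1}"
    by (auto simp: PiE_iff)
  with Conn.prems show ?case
    by (auto simp: connective_def continuous_map_in_subtopology PiE_iff Pi_iff)
next
  case (Sup_q i \<phi>)
  then have *: "fm_val \<phi> (v(i := a)) \<in> {0..1}" for a by simp
  then have "0 \<le> (SUP a. fm_val \<phi> (v(i := a)))"
    by (intro cSUP_upper2[of _ _ undefined]) (auto intro: bdd_aboveI2[where M = 1])
  moreover have "(SUP a. fm_val \<phi> (v(i := a))) \<le> 1" using * by (intro cSUP_least) auto
  ultimately show ?case by simp
next
  case (Inf_q i \<phi>)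
  then have *: "fm_val \<phi> (v(i := a)) \<in> {0..1}" for a by simp
  then have "(INF a. fm_val \<phi> (v(i := a))) \<le> 1"
    by (intro cINF_lower2[of _ _ undefined]) (auto intro: bdd_belowI2[where m = 0])
  moreover have "0 \<le> (INF a. fm_val \<phi> (v(i := a)))" using * by (intro cINF_greatest) auto
  ultimately show ?case by simp
qed (auto simp: d_le_eq r_eq dist_le_one)

lemma SUP_close:
  fixes f g :: "'a \<Rightarrow> real"
  assumes "bdd_above (range f)" "bdd_above (range g)"
    and "\<And>x. \<exists>y. \<bar>f x - g y\<bar> \<le> e" "\<And>y. \<exists>x. \<bar>f x - g y\<bar> \<le> e"
  shows "\<bar>(SUP x. f x) - (SUP x. g x)\<bar> \<le> e"
proof -
  have "f x \<le> (SUP x. g x) + e" for x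
    using assms(3)[of x] cSUP_upper[OF UNIV_I assms(2)] by (smt (verit))
  then have "(SUP x. f x) \<le> (SUP x. g x) + e" by (intro cSUP_least) auto
  moreover have "g y \<le> (SUP x. f x) + e" for y
    using assms(4)[of y] cSUP_upper[OF UNIV_I assms(1)] by (smt (verit))
  then have "(SUP x. g x) \<le> (SUP x. f x) + e" by (intro cSUP_least) auto
  ultimately show ?thesis by linarith
qed

lemma INF_close:
  fixes f g :: "'a \<Rightarrow> real"
  assumes "bdd_below (range f)" "bdd_below (range g)"
    and "\<And>x. \<exists>y. \<bar>f x - g y\<bar> \<le> e" "\<And>y. \<exists>x. \<bar>f x - g y\<bar> \<le> e"
  shows "\<bar>(INF x. f x) - (INF x. g x)\<bar> \<le> e"
proof -
  have "(INF x. g x) - e \<le> f x" for x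
    using assms(3)[of x] cINF_lower[OF assms(2) UNIV_I] by (smt (verit))
  then have "(INF x. g x) - e \<le> (INF x. f x)" by (intro cINF_greatest) auto
  moreover have "(INF x. f x) - e \<le> g y" for y
    using assms(4)[of y] cINF_lower[OF assms(1) UNIV_I] by (smt (verit))
  then have "(INF x. f x) - e \<le> (INF x. g x)" by (intro cINF_greatest) auto
  ultimately show ?thesis by linarith
qed

text \<open>The partial map on the elements that the formula can see. Parameters are fixed, and the
  map is finite, as the extension step requires.\<close>

definition matching :: "'a fm \<Rightarrow> (nat \<Rightarrow> 'a) \<Rightarrow> (nat \<Rightarrow> 'a) \<Rightarrow> ('a \<times> 'a) set" where
  "matching \<phi> v w = (\<lambda>a. (a, a)) ` set_fm \<phi> \<union> (\<lambda>i. (v i, w i)) ` free_vars \<phi>"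

lemma matching_converse: "(matching \<phi> v w)\<inverse> = matching \<phi> w v"
  unfolding matching_def by auto

lemma finite_matching: "finite (matching \<phi> v w)"
proof -
  have tm: "finite (set_tm t)" "finite (tm_vars t)" for t :: "'a tm" by (cases t; simp)+
  have "finite (set_fm \<phi>) \<and> finite (free_vars \<phi>)"
    by (induction \<phi>) (auto simp: tm)
  then show ?thesis by (simp add: matching_def)
qed

lemma tm_val_matching:
  "set_tm t \<subseteq> set_fm \<phi> \<Longrightarrow> tm_vars t \<subseteq> free_vars \<phi> \<Longrightarrow> (tm_val t v, tm_val t w) \<in> matching \<phi> v w"
  unfolding matching_def by (cases t) auto

lemma grid_similar_quantifier:
  fixes v w :: "nat \<Rightarrow> 'a::udlo"
  assumes sim: "grid_similar N (matching \<psi> v w)" and N: "0 < N"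
    and \<psi>: "set_fm \<phi> \<subseteq> set_fm \<psi>" "free_vars \<phi> \<subseteq> insert i (free_vars \<psi>)"
  shows "\<exists>y. grid_similar N (matching \<phi> (v(i := x)) (w(i := y)))"
proof -
  obtain y where "grid_similar N (insert (x, y) (matching \<psi> v w))"
    using grid_similar_extend[OF sim finite_matching N] by blast
  moreover have "matching \<phi> (v(i := x)) (w(i := y)) \<subseteq> insert (x, y) (matching \<psi> v w)"
  proof
    fix z assume "z \<in> matching \<phi> (v(i := x)) (w(i := y))"
    then consider a where "a \<in> set_fm \<phi>" "z = (a, a)"
      | j where "j \<in> free_vars \<phi>" "z = ((v(i := x)) j, (w(i := y)) j)"
      unfolding matching_def by blast
    then show "z \<in> insert (x, y) (matching \<psi> v w)"
    proof cases
      case 1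
      then show ?thesis using \<psi>(1) unfolding matching_def by blast
    next
      case (2 j)
      then show ?thesis using \<psi>(2) unfolding matching_def by (cases "j = i") auto
    qed
  qed
  ultimately show ?thesis using grid_similar_subset by blast
qed

lemma grid_similar_quantifier':
  fixes v w :: "nat \<Rightarrow> 'a::udlo"
  assumes "grid_similar N (matching \<psi> v w)" "0 < N"
    and "set_fm \<phi> \<subseteq> set_fm \<psi>" "free_vars \<phi> \<subseteq> insert i (free_vars \<psi>)"
  shows "\<exists>x. grid_similar N (matching \<phi> (v(i := x)) (w(i := y)))"
  using grid_similar_quantifier[of N \<psi> w v \<phi> i y] grid_similar_converse assms
  by (metis matching_converse)

section \<open>Dependence of formula values on the partial map\<close>

lemma eventually_inverse_nat_le:
  assumes "0 < e"
  shows "\<forall>\<^sub>F N in sequentially. 0 < N \<and> 1 / real N \<le> e"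
proof (intro eventually_conj eventually_gt_at_top)
  show "\<forall>\<^sub>F N in sequentially. 1 / real N \<le> e"
    using order_tendstoD(2)[OF lim_1_over_n assms] by (rule eventually_mono) simp
qed

text \<open>At fixed \<open>N\<close> quantifiers cost nothing, since extending the partial map
  matches every witness on either side. Atomic formulas cost \<open>1 / N\<close>, and connectives
  demand a smaller tolerance from their arguments; \<open>eventually\<close> absorbs the resulting
  choice of \<open>N\<close>.\<close>

lemma fm_val_close:
  fixes \<phi> :: "'a::udlo fm"
  assumes "formula_over A \<phi>" "0 < e"
  shows "\<forall>\<^sub>F N in sequentially. \<forall>v w. grid_similar N (matching \<phi> v w) \<longrightarrow>
    \<bar>fm_val \<phi> v - fm_val \<phi> w\<bar> \<le> e"
  using assms
proof (induction \<phi> arbitrary: e)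
  case (Dist s t)
  from eventually_inverse_nat_le[OF Dist.prems(2)] show ?case
  proof eventually_elim
    case (elim N)
    have "\<bar>dist (tm_val s v) (tm_val t v) - dist (tm_val s w) (tm_val t w)\<bar> \<le> 1 / N"
      if "grid_similar N (matching (Dist s t) v w)" for v w
      using elim by (intro lev_eq_imp_dist_close grid_similarD(1)[OF that])
        (auto intro!: tm_val_matching)
    with elim show ?case by fastforce
  qed
next
  case (Dle s t)
  from eventually_inverse_nat_le[OF Dle.prems(2)] show ?case
  proof eventually_elim
    case (elim N)
    \<comment> \<open>The bound is proved for \<open>r\<close>, with which \<open>d_le\<close>
      agrees.\<close>
    have "\<bar>r (tm_val s v) (tm_val t v) - r (tm_val s w) (tm_val t w)\<bar> \<le> 1 / N"
      if "grid_similar N (matching (Dle s t) v w)" for v w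
      using elim by (intro grid_similar_imp_r_close[OF _ that])
        (auto intro!: tm_val_matching)
    with elim show ?case by (fastforce simp: d_le_eq r_eq)
  qed
next
  case (Rel_r s t)
  from eventually_inverse_nat_le[OF Rel_r.prems(2)] show ?case
  proof eventually_elim
    case (elim N)
    have "\<bar>r (tm_val s v) (tm_val t v) - r (tm_val s w) (tm_val t w)\<bar> \<le> 1 / N"
      if "grid_similar N (matching (Rel_r s t) v w)" for v w
      using elim by (intro grid_similar_imp_r_close[OF _ that])
        (auto intro!: tm_val_matching)
    with elim show ?case by fastforce
  qed
next
  case (Conn u \<phi>s)
  let ?n = "length \<phi>s"
  let ?val = "\<lambda>v. restrict (nth (map (\<lambda>\<phi>. fm_val \<phi> v) \<phi>s)) {..<?n}"
  obtain d where "0 < d" and d: "\<And>x y. x \<in> {..<?n} \<rightarrow>\<^sub>E {0..1} \<Longrightarrow> y \<in> {..<?n} \<rightarrow>\<^sub>E {0..1} \<Longrightarrow>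
    (\<forall>i<?n. \<bar>x i - y i\<bar> \<le> d) \<Longrightarrow> \<bar>u x - u y\<bar> \<le> e"
    using connective_uniformly_continuous[of ?n u e] Conn.prems by auto
  have "\<forall>\<^sub>F N in sequentially. \<forall>\<phi>\<in>set \<phi>s. \<forall>v w. grid_similar N (matching \<phi> v w) \<longrightarrow>
      \<bar>fm_val \<phi> v - fm_val \<phi> w\<bar> \<le> d"
    using Conn \<open>0 < d\<close> by (intro eventually_ball_finite) auto
  then show ?case
  proof eventually_elim
    case (elim N)
    show ?case
    proof (intro allI impI)
      fix v w assume sim: "grid_similar N (matching (Conn u \<phi>s) v w)"
      have "\<bar>fm_val \<phi> v - fm_val \<phi> w\<bar> \<le> d" if "\<phi> \<in> set \<phi>s" for \<phi>
      proof -
        have "matching \<phi> v w \<subseteq> matching (Conn u \<phi>s) v w"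
          using that unfolding matching_def by auto
        with sim elim that show ?thesis using grid_similar_subset by blast
      qed
      moreover have "?val v \<in> {..<?n} \<rightarrow>\<^sub>E {0..1}" for v
        using Conn.prems fm_val_bounds[of A] by (auto simp: PiE_iff)
      ultimately have "\<bar>u (?val v) - u (?val w)\<bar> \<le> e"
        by (intro d) auto
      then show "\<bar>fm_val (Conn u \<phi>s) v - fm_val (Conn u \<phi>s) w\<bar> \<le> e" by simp
    qed
  qed
next
  case (Sup_q i \<phi>)
  have bdd: "bdd_above (range (\<lambda>a. fm_val \<phi> (v(i := a))))" for v
    using fm_val_bounds[of A \<phi>] Sup_q.prems by (intro bdd_aboveI2[where M = 1]) auto
  have "\<forall>\<^sub>F N in sequentially. 0 < N \<and> (\<forall>v w. grid_similar N (matching \<phi> v w) \<longrightarrow>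
      \<bar>fm_val \<phi> v - fm_val \<phi> w\<bar> \<le> e)"
    using Sup_q by (intro eventually_conj eventually_gt_at_top) auto
  then show ?case
  proof eventually_elim
    case (elim N)
    show ?case
    proof (intro allI impI)
      fix v w assume sim: "grid_similar N (matching (Sup_q i \<phi>) v w)"
      show "\<bar>fm_val (Sup_q i \<phi>) v - fm_val (Sup_q i \<phi>) w\<bar> \<le> e"
        unfolding fm_val.simps
      proof (rule SUP_close[OF bdd bdd])
        fix x show "\<exists>y. \<bar>fm_val \<phi> (v(i := x)) - fm_val \<phi> (w(i := y))\<bar> \<le> e"
          using grid_similar_quantifier[OF sim, of \<phi> i x] elim by auto
      next
        fix y show "\<exists>x. \<bar>fm_val \<phi> (v(i := x)) - fm_val \<phi> (w(i := y))\<bar> \<le> e"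
          using grid_similar_quantifier'[OF sim, of \<phi> i y] elim by auto
      qed
    qed
  qed
next
  case (Inf_q i \<phi>)
  have bdd: "bdd_below (range (\<lambda>a. fm_val \<phi> (v(i := a))))" for v
    using fm_val_bounds[of A \<phi>] Inf_q.prems by (intro bdd_belowI2[where m = 0]) auto
  have "\<forall>\<^sub>F N in sequentially. 0 < N \<and> (\<forall>v w. grid_similar N (matching \<phi> v w) \<longrightarrow>
      \<bar>fm_val \<phi> v - fm_val \<phi> w\<bar> \<le> e)"
    using Inf_q by (intro eventually_conj eventually_gt_at_top) auto
  then show ?case
  proof eventually_elim
    case (elim N)
    show ?case
    proof (intro allI impI)
      fix v w assume sim: "grid_similar N (matching (Inf_q i \<phi>) v w)"
      show "\<bar>fm_val (Inf_q i \<phi>) v - fm_val (Inf_q i \<phi>) w\<bar> \<le> e"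
        unfolding fm_val.simps
      proof (rule INF_close[OF bdd bdd])
        fix x show "\<exists>y. \<bar>fm_val \<phi> (v(i := x)) - fm_val \<phi> (w(i := y))\<bar> \<le> e"
          using grid_similar_quantifier[OF sim, of \<phi> i x] elim by auto
      next
        fix y show "\<exists>x. \<bar>fm_val \<phi> (v(i := x)) - fm_val \<phi> (w(i := y))\<bar> \<le> e"
          using grid_similar_quantifier'[OF sim, of \<phi> i y] elim by auto
      qed
    qed
  qed
qed

lemma fm_val_eq_if_grid_similar:
  fixes \<phi> :: "'a::udlo fm"
  assumes "formula_over A \<phi>" "\<And>N. grid_similar N (matching \<phi> v w)"
  shows "fm_val \<phi> v = fm_val \<phi> w"
proof -
  have "\<bar>fm_val \<phi> v - fm_val \<phi> w\<bar> \<le> e" if "0 < e" for e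
    using eventually_happens[OF fm_val_close[OF assms(1) that]] assms(2) by auto
  then have "\<bar>fm_val \<phi> v - fm_val \<phi> w\<bar> \<le> 0" by (rule dense_ge)
  then show ?thesis by simp
qed

section \<open>Algebraic closure\<close>

lemma formula_over_imp_params: "formula_over A \<phi> \<Longrightarrow> set_fm \<phi> \<subseteq> A"
  by (induction \<phi>) auto

text \<open>The open ball around \<open>b\<close> that just misses \<open>a\<close> looks like a
  single point from \<open>a\<close>, by the isosceles property and convexity.\<close>

lemma dist_eq_if_near:
  fixes a b c :: "'a::udlo"
  assumes "dist b c < dist b a"
  shows "dist c a = dist b a" "c < a \<longleftrightarrow> b < a"
proof -
  show "dist c a = dist b a"
    using assms ultrametric[of c a b] ultrametric[of b a c] by (auto simp: dist_commute)
  show "c < a \<longleftrightarrow> b < a"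
    using assms dist_mono_between[of b a c] dist_mono_between[of c a b]
    by (metis dist_commute leD less_imp_le not_le)
qed

text \<open>Fixing \<open>A\<close> pointwise and sending \<open>b\<close> to \<open>c\<close>
  preserves distances and order, hence is similar at every resolution, so each approximating formula
  takes equal values at \<open>b\<close> and \<open>c\<close>.\<close>

lemma definable_pred_eq_on_ball:
  fixes A :: "'a::udlo set"
  assumes P: "definable_pred A 1 P" and far: "\<And>a. a \<in> A \<Longrightarrow> e \<le> dist b a"
    and c: "dist b c < e"
  shows "P (\<lambda>_. b) = P (\<lambda>_. c)"
proof -
  obtain \<phi> where \<phi>: "\<And>k. formula_over A (\<phi> k)" "\<And>k. free_vars (\<phi> k) \<subseteq> {..<1}"
    and lim: "uniform_limit UNIV (\<lambda>k. fm_val (\<phi> k)) P sequentially"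
    using P unfolding definable_pred_def by auto
  have "fm_val (\<phi> k) (\<lambda>_. b) = fm_val (\<phi> k) (\<lambda>_. c)" for k
  proof (rule fm_val_eq_if_grid_similar[OF \<phi>(1)])
    fix N
    \<comment> \<open>\<open>A\<close> may be infinite: similarity is checked on all of it and then
      restricted to the finite matching.\<close>
    have "grid_similar N ((\<lambda>a. (a, a)) ` A)" by (auto simp: grid_similar_def)
    then have "grid_similar N (insert (b, c) ((\<lambda>a. (a, a)) ` A))"
    proof (rule grid_similar_insert)
      fix p q assume "(p, q) \<in> (\<lambda>a. (a, a)) ` A"
      then have "p = q" "dist b c < dist b p" using far c by force+
      then show "lev N b p = lev N c q \<and> (1 < lev N b p \<longrightarrow> (b < p \<longleftrightarrow> c < q))"
        using dist_eq_if_near[of b c p] by (simp add: lev_def)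
    qed
    moreover have "matching (\<phi> k) (\<lambda>_. b) (\<lambda>_. c) \<subseteq> insert (b, c) ((\<lambda>a. (a, a)) ` A)"
      using formula_over_imp_params[OF \<phi>(1)] unfolding matching_def by blast
    ultimately show "grid_similar N (matching (\<phi> k) (\<lambda>_. b) (\<lambda>_. c))"
      by (rule grid_similar_subset)
  qed
  then show ?thesis
    using tendsto_uniform_limitI[OF lim UNIV_I, of "\<lambda>_. b"]
      tendsto_uniform_limitI[OF lim UNIV_I, of "\<lambda>_. c"] LIMSEQ_unique by auto
qed

text \<open>A finite net of mesh \<open>e / 2\<close> would leave only finitely many values for the distances from the
  centre that exceed \<open>e / 2\<close>, yet these are dense.\<close>

lemma not_compact_if_contains_ball:
  fixes D :: "'a::udlo set"
  assumes "ball b e \<subseteq> D" "0 < e"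
  shows "\<not> compact D"
proof
  assume "compact D"
  \<comment> \<open>Distances are dense only in the unit interval, so the radius is cut off at
    1.\<close>
  define h where "h = min e 1"
  have h: "0 < h" "h \<le> e" "h \<le> 1" using \<open>0 < e\<close> by (auto simp: h_def)
  then obtain X where X: "finite X" "D \<subseteq> (\<Union>x\<in>X. ball x (h / 2))"
    using compact_imp_seq_compact[OF \<open>compact D\<close>] seq_compact_imp_totally_bounded
    by (metis half_gt_zero)
  let ?U = "{h / 2<..<h} - dist b ` X"
  have "open ?U" using X by (intro open_Diff finite_imp_closed) auto
  moreover have "infinite ?U" using X h by (intro Diff_infinite_finite) (auto simp: infinite_Ioo)
  then obtain t where t: "t \<in> ?U" using infinite_imp_nonempty by blast
  moreover have "t \<in> closure {dist b c |c. b < c}"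
    using t h by (intro subsetD[OF dense_dist_above]) auto
  ultimately have "?U \<inter> {dist b c |c. b < c} \<noteq> {}"
    using open_Int_closure_eq_empty by blast
  then obtain c where c: "h / 2 < dist b c" "dist b c < h" "dist b c \<notin> dist b ` X" by auto
  then have "c \<in> D" using assms h by auto
  then obtain x where x: "x \<in> X" "dist x c < h / 2" using X by auto
  \<comment> \<open>The net point \<open>x\<close> is closer to \<open>c\<close> than
    \<open>b\<close> is, so it has the same distance from \<open>b\<close> as \<open>c\<close>, a
    value that was excluded.\<close>
  then have "dist c x < dist c b" using c by (simp add: dist_commute)
  then have "dist b x = dist b c" using dist_eq_if_near(1)[of c x b] by (simp add: dist_commute)
  with x c show False by (metis imageI)
qed

lemma acl_subset_closure:
  fixes A :: "'a::udlo set"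
  shows "acl A \<subseteq> closure A"
proof
  fix b assume "b \<in> acl A"
  then obtain D where D: "compact D" "definable_set A D" "b \<in> D" by (auto simp: acl_def)
  show "b \<in> closure A"
  proof (rule ccontr)
    assume "b \<notin> closure A"
    then obtain e where e: "0 < e" "\<And>a. a \<in> A \<Longrightarrow> e \<le> dist b a"
      by (auto simp: closure_approachable dist_commute not_less)
    have "c \<in> D" if "dist b c < e" for c
    proof -
      \<comment> \<open>The distance to \<open>D\<close> vanishes at \<open>b\<close>, hence at
        \<open>c\<close>, and \<open>D\<close> is closed.\<close>
      have "infdist b D = infdist c D"
        using definable_pred_eq_on_ball[OF _ e(2) that] D(2) by (auto simp: definable_set_def)
      then show ?thesis
        using D by (metis definable_set_def in_closed_iff_infdist_zero)
    qed
    then have "ball b e \<subseteq> D" by auto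
    with not_compact_if_contains_ball e(1) D(1) show False by blast
  qed
qed

text \<open>The compact set \<open>{b}\<close> is a witness: the distances to points of
  \<open>A\<close> converging to \<open>b\<close> approximate the distance to \<open>b\<close>
  uniformly.\<close>

lemma closure_subset_acl:
  fixes A :: "'a::metric_linorder set"
  shows "closure A \<subseteq> acl A"
proof
  fix b assume "b \<in> closure A"
  then obtain a where a: "\<And>k. a k \<in> A" "a \<longlonglongrightarrow> b" by (auto simp: closure_sequential)
  have "uniform_limit UNIV (\<lambda>k. fm_val (Dist (Var 0) (Param (a k)))) (\<lambda>v. infdist (v 0) {b}) sequentially"
  proof (rule uniform_limitI)
    fix e :: real assume "0 < e"
    then have "\<forall>\<^sub>F k in sequentially. dist (a k) b < e" using a(2) by (rule tendstoD[rotated])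
    then show "\<forall>\<^sub>F k in sequentially. \<forall>v\<in>UNIV.
        dist (fm_val (Dist (Var 0) (Param (a k))) v) (infdist (v 0) {b}) < e"
    proof eventually_elim
      case (elim k)
      have "\<bar>dist x (a k) - dist x b\<bar> \<le> dist (a k) b" for x
        by (metis abs_dist_diff_le dist_commute)
      with elim show ?case by (auto simp: dist_real_def intro: le_less_trans)
    qed
  qed
  moreover have "formula_over A (Dist (Var 0) (Param (a k)))"
    "free_vars (Dist (Var 0) (Param (a k))) \<subseteq> {..<1}" for k
    using a(1) by auto
  ultimately have "definable_pred A 1 (\<lambda>v. infdist (v 0) {b})"
    unfolding definable_pred_def by (intro exI[of _ "\<lambda>k. Dist (Var 0) (Param (a k))"]) blast
  then show "b \<in> acl A"
    unfolding acl_def definable_set_def by (auto intro!: exI[of _ "{b}"])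
qed

theorem theorem4p34:
  fixes A :: "'a::udlo set"
  shows "acl A = closure A"
  using acl_subset_closure closure_subset_acl by (rule equalityI)

end
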